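(* Let $\epsilon>0$ and let $\{\omega_n\}_{n=1}^\infty$ be an increasing sequence of positive real numbers such that $\int_{\omega_n}^\infty \Xi(t)\,dt=0$ and $\omega_{n+1}-\omega_n<\omega_n^{\frac16+\epsilon}$ for all $n=1,2,\dots$. Then $$\int_{\omega_n}^{\omega_{n+1}}\Xi(t)\,dt=0,\qquad n=1,2,\dots,$$ and consequently $$\int_{[\omega_n,\omega_{n+1}]^+}\Xi(t)\,dt=-\int_{[\omega_n,\omega_{n+1}]^-}\Xi(t)\,dt,\qquad n=1,2,\dots,$$ where $[\omega_n,\omega_{n+1}]^+=\{t\in[\omega_n,\omega_{n+1}]:\ \Xi(t)>0\}$ and $[\omega_n,\omega_{n+1}]^-=\{t\in[\omega_n,\omega_{n+1}]:\ \Xi(t)<0\}$.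
   Context: Here $\Xi(z)=\xi\left(\frac12+iz\right)$, where $\xi(s)=\frac{s(s-1)}{2}\pi^{-s/2}\Gamma\left(\frac s2\right)\zeta(s)$, with $\zeta$ the Riemann zeta-function and $\Gamma$ the Gamma function. The function $\Xi(t)$ is real for real $t$. *)

theory Defs
  imports "HOL-Complex_Analysis.Complex_Analysis"
begin

text \<open>The analytic continuation of the Dirichlet series to the plane without the pole at 1.
  It is unique by connectedness of the domain once the otherwise meaningless value at the
  pole is fixed; this value is 0, following the library convention for Gamma.\<close>

definition zeta :: "complex \<Rightarrow> complex" where
  "zeta = (THE f. f holomorphic_on (- {1}) \<and>
                  (\<forall>s. Re s > 1 \<longrightarrow> f s = (\<Sum>n. 1 / of_nat (Suc n) powr s)) \<and>
                  f 1 = 0)"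

text \<open>At 1, 0, -2, -4, ..., where zeta or Gamma has a pole, this formula evaluates to 0 rather
  than to the limit. These points do not lie on the critical line, so values of the
  function \<open>Xi\<close> below at real arguments are not affected.\<close>

definition xi :: "complex \<Rightarrow> complex" where
  "xi s = s * (s - 1) / 2 * of_real pi powr (- s / 2) * Gamma (s / 2) * zeta s"

definition Xi :: "complex \<Rightarrow> complex" where
  "Xi z = xi (1 / 2 + \<i> * z)"

text \<open>The function \<open>Xi\<close> is real on the real line; its value there, as a real number, is
  given by the following function.\<close>

definition Xi_real :: "real \<Rightarrow> real" where
  "Xi_real t = Re (Xi (of_real t))"

end

theory Submission
  imports Defs
begin

text \<open>The first conclusion is additivity of the integral: \<open>[\<omega> n, \<infinity>)\<close> is the union of
  \<open>[\<omega> n, \<omega> (n + 1)]\<close> and \<open>[\<omega> (n + 1), \<infinity>)\<close>, and the integrals over both half-lines vanish.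
  The second follows by splitting \<open>[\<omega> n, \<omega> (n + 1)]\<close> according to the sign of the integrand.
  Since the Bochner integral of a function that is not integrable is 0 by convention, additivity
  needs a proof that \<open>Xi_real\<close> is integrable on the half-lines (\<open>set_integrable_Xi_real\<close>), and
  this is where the work lies. It takes two ingredients.

  The first is that \<open>zeta\<close>, which is given by a definite description, really is the
  analytic continuation of the Dirichlet series. Write \<open>D s\<close> for the sum of
  \<open>m powr (- s)\<close> over \<open>m \<ge> 1\<close>, where \<open>Re s > 1\<close>. The differences
  \<open>m powr (1 - s) - (m + 1) powr (1 - s)\<close> sum up to 1. Replacing \<open>(m + 1) powr (1 - s)\<close> by its
  Taylor polynomial of order \<open>K\<close> around \<open>m\<close> turns this into an identity that expresses
  \<open>(s - 1) * D s\<close> by the values of the same function at \<open>s + 1, ..., s + K - 1\<close> and the sum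
  of the Taylor remainders (\<open>dirichlet_zeta_recurrence\<close>). The remainder for \<open>m\<close> is
  of order \<open>m powr (- Re s - K)\<close>, so its sum is holomorphic for \<open>Re s > 1 - K\<close>, and the identity
  extends \<open>(s - 1) * D s\<close> from one half-plane to the next one, strip by strip
  (\<open>half_plane_continuation\<close>).

  The second is a bound for \<open>xi\<close> on the critical line. For \<open>K = 1\<close> the same identity shows that
  \<open>(s - 1) * zeta s\<close> grows at most quadratically there (\<open>norm_zeta_le\<close>). The Gamma factor decays
  faster than any power: \<open>Gamma z\<close> is \<open>Gamma (z + k)\<close> divided by \<open>z (z + 1) ... (z + k - 1)\<close>,
  and the numerator is bounded on vertical lines (\<open>norm_Gamma_decay\<close>). With \<open>k = 5\<close> the product
  of all factors of \<open>xi\<close> is of order \<open>1 / t\<^sup>2\<close>, which is integrable.\<close>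

section \<open>The Dirichlet series\<close>

definition dirichlet_zeta :: "complex \<Rightarrow> complex" where
  "dirichlet_zeta s = (\<Sum>n. 1 / of_nat (Suc n) powr s)"

lemma norm_powr_nat: "norm (of_nat (Suc n) powr s :: complex) = real (Suc n) powr Re s"
  by (subst norm_powr_real_powr) auto

lemma summable_Suc_powr: "p > 1 \<Longrightarrow> summable (\<lambda>n. real (Suc n) powr (- p))"
  using summable_Suc_iff[of "\<lambda>n. real n powr (- p)"] summable_real_powr_iff[of "- p"] by simp

lemma dirichlet_zeta_sums:
  assumes "Re s > 1"
  shows "(\<lambda>n. of_nat (Suc n) powr (- s)) sums dirichlet_zeta s"
proof -
  have "summable (\<lambda>n. norm (of_nat (Suc n) powr (- s) :: complex))"
    using summable_Suc_powr[OF assms] by (simp only: norm_powr_nat uminus_complex.sel)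
  then have "summable (\<lambda>n. of_nat (Suc n) powr (- s) :: complex)"
    by (rule summable_norm_cancel)
  then show ?thesis
    unfolding dirichlet_zeta_def powr_minus_divide by (rule summable_sums)
qed

lemma holomorphic_on_dominated_series:
  fixes f :: "nat \<Rightarrow> complex \<Rightarrow> complex"
  assumes "open S" and "\<And>n. f n holomorphic_on S"
    and "\<And>z. z \<in> S \<Longrightarrow> \<exists>d>0. cball z d \<subseteq> S \<and>
                   (\<exists>M. summable M \<and> (\<forall>n. \<forall>w\<in>cball z d. norm (f n w) \<le> M n))"
  shows "(\<lambda>z. \<Sum>n. f n z) holomorphic_on S"
proof (rule holomorphic_uniform_sequence[OF \<open>open S\<close>])
  show "(\<lambda>z. \<Sum>i<n. f i z) holomorphic_on S" for n
    by (intro holomorphic_intros assms)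
  fix z assume "z \<in> S"
  from assms(3)[OF this] obtain d M where "d > 0" "cball z d \<subseteq> S" and M: "summable M"
    "\<And>n w. w \<in> cball z d \<Longrightarrow> norm (f n w) \<le> M n" by blast
  then show "\<exists>d>0. cball z d \<subseteq> S \<and>
      uniform_limit (cball z d) (\<lambda>n z. \<Sum>i<n. f i z) (\<lambda>z. \<Sum>n. f n z) sequentially"
    using Weierstrass_m_test[of "cball z d" f M] by blast
qed

text \<open>The bound is uniform on small discs: a disc inside the open half-plane stays a positive
  distance away from the boundary line, so that the exponent there is bounded away from \<open>- 1\<close>,
  while \<open>c\<close> is bounded on the disc by compactness.\<close>

lemma holomorphic_on_series_half_plane:
  fixes f :: "nat \<Rightarrow> complex \<Rightarrow> complex" and c :: "complex \<Rightarrow> complex"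
  assumes holo: "\<And>n. f n holomorphic_on UNIV" and cont: "continuous_on UNIV c"
    and bound: "\<And>n s. Re s > 1 - k \<Longrightarrow> norm (f n s) \<le> norm (c s) * real (Suc n) powr (- (Re s + k))"
  shows "(\<lambda>s. \<Sum>n. f n s) holomorphic_on {s. Re s > 1 - k}"
proof (rule holomorphic_on_dominated_series)
  show "open {s. Re s > 1 - k}" by (rule open_halfspace_Re_gt)
  show "f n holomorphic_on {s. Re s > 1 - k}" for n
    using holo by (rule holomorphic_on_subset) simp
  fix z assume z: "z \<in> {s. Re s > 1 - k}"
  define d where "d = (Re z + k - 1) / 2"
  have d: "d > 0" using z by (simp add: d_def)
  have Re_ge: "Re w \<ge> Re z - d" if "w \<in> cball z d" for w
    using that abs_Re_le_cmod[of "z - w"] by (auto simp: dist_norm)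
  have gap: "Re z - d > 1 - k" using z by (simp add: d_def field_simps)
  have sub: "cball z d \<subseteq> {s. Re s > 1 - k}"
    using Re_ge gap by force
  have "compact (c ` cball z d)"
    by (intro compact_continuous_image continuous_on_subset[OF cont]) auto
  then obtain C where C: "\<And>w. w \<in> cball z d \<Longrightarrow> norm (c w) \<le> C"
    by (meson bounded_iff compact_imp_bounded imageI)
  define p where "p = Re z - d + k"
  have p: "p > 1" using gap by (simp add: p_def)
  have "norm (f n w) \<le> C * real (Suc n) powr (- p)" if w: "w \<in> cball z d" for n w
  proof -
    have "norm (f n w) \<le> norm (c w) * real (Suc n) powr (- (Re w + k))"
      using bound sub w by auto
    also have "\<dots> \<le> C * real (Suc n) powr (- p)"
      using Re_ge[OF w] C[OF w] order_trans[OF norm_ge_zero C[OF w]]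
      by (intro mult_mono powr_mono) (auto simp: p_def)
    finally show ?thesis .
  qed
  moreover have "summable (\<lambda>n. C * real (Suc n) powr (- p))"
    using summable_Suc_powr[OF p] by (rule summable_mult)
  ultimately show "\<exists>d>0. cball z d \<subseteq> {s. Re s > 1 - k} \<and>
      (\<exists>M. summable M \<and> (\<forall>n. \<forall>w\<in>cball z d. norm (f n w) \<le> M n))"
    using d sub by blast
qed

lemma holomorphic_dirichlet_zeta: "dirichlet_zeta holomorphic_on {s. Re s > 1}"
proof -
  have "(\<lambda>s. \<Sum>n. 1 / of_nat (Suc n) powr s :: complex) holomorphic_on {s. Re s > 1 - 0}"
  proof (rule holomorphic_on_series_half_plane)
    show "(\<lambda>s. 1 / of_nat (Suc n) powr s :: complex) holomorphic_on UNIV" for n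
      by (intro holomorphic_intros) auto
    show "continuous_on UNIV (\<lambda>s. 1 :: complex)" by simp
    show "norm (1 / of_nat (Suc n) powr s :: complex) \<le> norm (1::complex) * real (Suc n) powr (- (Re s + 0))" for n s
      by (simp only: norm_divide norm_powr_nat powr_minus_divide) simp
  qed
  then show ?thesis by (simp add: dirichlet_zeta_def[abs_def])
qed

section \<open>Analytic continuation of the zeta function\<close>

text \<open>The Taylor expansion of \<open>x powr (1 - s)\<close> around a positive integer \<open>m\<close> with increment 1 has
  the terms \<open>taylor_coeff s i * m powr (1 - s - i)\<close>: the sign and the Pochhammer symbol form the
  falling factorial of \<open>1 - s\<close> that repeated differentiation produces.\<close>

definition taylor_coeff :: "complex \<Rightarrow> nat \<Rightarrow> complex" where
  "taylor_coeff s i = (- 1) ^ i * pochhammer (s - 1) i / fact i"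

text \<open>The expansion point is \<open>Suc n\<close> because the index set of the series starts at 0, whereas
  the Dirichlet series starts at 1.\<close>

definition taylor_rem :: "nat \<Rightarrow> nat \<Rightarrow> complex \<Rightarrow> complex" where
  "taylor_rem K n s = of_nat (Suc (Suc n)) powr (1 - s)
     - (\<Sum>i\<le>K. taylor_coeff s i * of_nat (Suc n) powr (1 - s - of_nat i))"

text \<open>The derivative of order \<open>K + 1\<close> of \<open>x powr (1 - s)\<close> is a multiple of
  \<open>x powr (- s - K)\<close>. Under the hypothesis on \<open>s\<close> its modulus is decreasing in \<open>x > 0\<close>, hence on
  \<open>[n + 1, n + 2]\<close> it is largest at the left end.\<close>

lemma norm_taylor_rem_le:
  assumes "Re s + real K \<ge> 0"
  shows "norm (taylor_rem K n s)
           \<le> norm (pochhammer (s - 1) (Suc K) / fact K) * real (Suc n) powr (- (Re s + K))"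
proof -
  define f where "f = (\<lambda>i x. (- 1) ^ i * pochhammer (s - 1) i * x powr (1 - s - of_nat i) :: complex)"
  define a b :: complex where "a = of_nat (Suc n)" and "b = of_nat (Suc (Suc n))"
  define S where "S = closed_segment a b"
  define B where "B = norm (pochhammer (s - 1) (Suc K)) * real (Suc n) powr (- (Re s + K))"
  have S: "x \<in> \<real>" "Re x \<ge> real (Suc n)" if "x \<in> S" for x
  proof -
    have "x \<in> closed_segment (complex_of_real (real (Suc n))) (of_real (real (Suc (Suc n))))"
      using that by (simp only: S_def a_def b_def of_real_of_nat_eq)
    then have "x \<in> of_real ` closed_segment (real (Suc n)) (real (Suc (Suc n)))"
      by (simp only: closed_segment_of_real)
    then show "x \<in> \<real>" "Re x \<ge> real (Suc n)"
      by (auto simp: closed_segment_eq_real_ivl split: if_splits)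
  qed
  have "norm (f 0 b - (\<Sum>i\<le>K. f i a * (b - a) ^ i / fact i)) \<le> B * norm (b - a) ^ Suc K / fact K"
  proof (rule complex_Taylor)
    show "convex S" "a \<in> S" "b \<in> S" by (auto simp: S_def)
    fix x assume x: "x \<in> S"
    have x0: "x \<notin> \<real>\<^sub>\<le>\<^sub>0" using S[OF x] by (auto simp: complex_nonpos_Reals_iff)
    show "(f i has_field_derivative f (Suc i) x) (at x within S)" for i
    proof -
      define c e where "c = (- 1) ^ i * pochhammer (s - 1) i" and "e = 1 - s - of_nat i"
      have "((\<lambda>x. c * x powr e) has_field_derivative c * (e * x powr (e - 1))) (at x within S)"
        by (intro DERIV_cmult has_field_derivative_at_within[OF has_field_derivative_powr] x0)
      moreover have "e - 1 = 1 - s - of_nat (Suc i)" "c * e = (- 1) ^ Suc i * pochhammer (s - 1) (Suc i)"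
        by (simp_all add: c_def e_def pochhammer_Suc algebra_simps)
      ultimately show ?thesis
        unfolding f_def by (simp only: c_def e_def mult.assoc[symmetric])
    qed
    have "norm (f (Suc K) x) = norm (pochhammer (s - 1) (Suc K)) * Re x powr (- (Re s + K))"
      using S[OF x] unfolding f_def
      by (simp add: norm_mult norm_power norm_powr_real_powr del: pochhammer_Suc)
    also have "\<dots> \<le> B"
      unfolding B_def using S[OF x] assms
      by (intro mult_left_mono powr_mono2') auto
    finally show "norm (f (Suc K) x) \<le> B" .
  qed
  moreover have "b - a = 1" by (simp add: a_def b_def)
  moreover have "f 0 b - (\<Sum>i\<le>K. f i a / fact i) = taylor_rem K n s"
    by (simp add: f_def taylor_rem_def a_def b_def taylor_coeff_def)
  ultimately show ?thesis by (simp add: B_def norm_divide)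
qed

lemma taylor_coeff_Suc:
  "taylor_coeff s (Suc i) = - (taylor_coeff s i * (s + of_nat i - 1) / of_nat (Suc i))"
  by (simp add: taylor_coeff_def pochhammer_Suc add.commute diff_add_eq mult.assoc mult.commute)

lemma holomorphic_taylor_coeff: "(\<lambda>s. taylor_coeff s i) holomorphic_on A"
  unfolding taylor_coeff_def by (intro holomorphic_intros) auto

lemma holomorphic_taylor_rem_suminf:
  "(\<lambda>s. \<Sum>n. taylor_rem K n s) holomorphic_on {s. Re s > 1 - real K}"
proof (rule holomorphic_on_series_half_plane)
  show "taylor_rem K n holomorphic_on UNIV" for n
    unfolding taylor_rem_def[abs_def] by (intro holomorphic_intros holomorphic_taylor_coeff)
  show "continuous_on UNIV (\<lambda>s::complex. pochhammer (s - 1) (Suc K) / fact K)"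
    by (intro holomorphic_on_imp_continuous_on holomorphic_intros) auto
  show "norm (taylor_rem K n s) \<le> norm (pochhammer (s - 1) (Suc K) / fact K) * real (Suc n) powr (- (Re s + K))"
    if "Re s > 1 - real K" for n s
    using that by (intro norm_taylor_rem_le) simp
qed

text \<open>Summing the Taylor expansions over \<open>n\<close> gives \<open>- 1\<close> on the side of the telescoping
  differences, and the term of order \<open>j + 1\<close> contributes a multiple of the Dirichlet series at
  \<open>s + j\<close>. Its coefficient contains the factor \<open>s + j - 1\<close>, which cancels the pole of the zeta
  function at \<open>s + j = 1\<close>. This makes the identity a recurrence for \<open>(s - 1) * dirichlet_zeta s\<close>,
  which extends to an entire function.\<close>

lemma dirichlet_zeta_recurrence:
  assumes s: "Re s > 1"
  shows "(s - 1) * dirichlet_zeta s = 1 + (\<Sum>n. taylor_rem (Suc N) n s)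
    - (\<Sum>j=1..N. taylor_coeff s j / of_nat (Suc j) * ((s + of_nat j - 1) * dirichlet_zeta (s + of_nat j)))"
proof -
  let ?p = "\<lambda>n. of_nat (Suc n) powr (1 - s) :: complex"
  let ?a = "\<lambda>j. taylor_coeff s j / of_nat (Suc j) * ((s + of_nat j - 1) * dirichlet_zeta (s + of_nat j))"
  have lim: "?p \<longlonglongrightarrow> 0"
  proof (rule tendsto_norm_zero_cancel)
    have "(\<lambda>n. real n powr (1 - Re s)) \<longlonglongrightarrow> 0"
      using s by (intro tendsto_neg_powr filterlim_real_sequentially) auto
    then show "(\<lambda>n. norm (?p n)) \<longlonglongrightarrow> 0"
      unfolding norm_powr_nat using LIMSEQ_Suc by fastforce
  qed
  have tele: "(\<lambda>n. ?p (Suc n) - ?p n) sums (- 1)"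
    using telescope_sums[OF lim] by simp
  have zs: "(\<lambda>n. of_nat (Suc n) powr (1 - s - of_nat (Suc i))) sums dirichlet_zeta (s + of_nat i)" for i
    using dirichlet_zeta_sums[of "s + of_nat i"] s by (simp add: algebra_simps)
  have "(\<lambda>n. (?p (Suc n) - ?p n)
             - (\<Sum>i\<le>N. taylor_coeff s (Suc i) * of_nat (Suc n) powr (1 - s - of_nat (Suc i))))
          sums (- 1 - (\<Sum>i\<le>N. taylor_coeff s (Suc i) * dirichlet_zeta (s + of_nat i)))"
    by (intro sums_diff tele sums_sum sums_mult zs)
  also have "(\<lambda>n. (?p (Suc n) - ?p n)
             - (\<Sum>i\<le>N. taylor_coeff s (Suc i) * of_nat (Suc n) powr (1 - s - of_nat (Suc i))))
      = (\<lambda>n. taylor_rem (Suc N) n s)"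
    unfolding taylor_rem_def sum.atMost_Suc_shift by (simp add: taylor_coeff_def algebra_simps)
  finally have "(\<Sum>n. taylor_rem (Suc N) n s)
      = - 1 - (\<Sum>i\<le>N. taylor_coeff s (Suc i) * dirichlet_zeta (s + of_nat i))"
    by (rule sums_unique[symmetric])
  also have "(\<Sum>i\<le>N. taylor_coeff s (Suc i) * dirichlet_zeta (s + of_nat i)) = - (\<Sum>i\<le>N. ?a i)"
    unfolding sum_negf[symmetric]
    by (intro sum.cong refl) (simp add: taylor_coeff_Suc mult.assoc del: of_nat_Suc)
  also have "(\<Sum>i\<le>N. ?a i) = (s - 1) * dirichlet_zeta s + (\<Sum>j=1..N. ?a j)"
    unfolding atMost_atLeast0 by (subst sum.atLeast_Suc_atMost) (auto simp: taylor_coeff_def)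
  finally show ?thesis by (simp add: algebra_simps)
qed

text \<open>The right-hand side of the recurrence is meaningful one strip further to the left than its
  left-hand side: the shifts \<open>s + j\<close> with \<open>j \<ge> 1\<close> lie in the half-plane already reached, and
  the sum of the remainders converges in the new one.\<close>

lemma half_plane_continuation:
  "\<exists>F. F holomorphic_on {s. Re s > 1 - real N} \<and>
       (\<forall>s. Re s > 1 \<longrightarrow> F s = (s - 1) * dirichlet_zeta s)"
proof (induction N)
  case 0
  have "(\<lambda>s. (s - 1) * dirichlet_zeta s) holomorphic_on {s. Re s > 1}"
    by (intro holomorphic_intros holomorphic_dirichlet_zeta)
  then show ?case by auto
next
  case (Suc N)
  then obtain F where F: "F holomorphic_on {s. Re s > 1 - real N}"
    and F_eq: "\<And>s. Re s > 1 \<Longrightarrow> F s = (s - 1) * dirichlet_zeta s" by blast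
  define G where "G = (\<lambda>s. 1 + (\<Sum>n. taylor_rem (Suc N) n s)
    - (\<Sum>j=1..N. taylor_coeff s j / of_nat (Suc j) * F (s + of_nat j)))"
  have shifted: "(\<lambda>s. F (s + of_nat j)) holomorphic_on {s. Re s > 1 - real (Suc N)}"
    if "j \<in> {1..N}" for j
    using that
    by (intro holomorphic_on_compose_gen[OF _ F, unfolded o_def] holomorphic_intros) auto
  have "G holomorphic_on {s. Re s > 1 - real (Suc N)}"
    unfolding G_def
    by (intro holomorphic_intros holomorphic_taylor_rem_suminf holomorphic_taylor_coeff shifted) auto
  moreover have "G s = (s - 1) * dirichlet_zeta s" if s: "Re s > 1" for s
  proof -
    have "F (s + of_nat j) = (s + of_nat j - 1) * dirichlet_zeta (s + of_nat j)" for j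
      using s by (intro F_eq) simp
    then show ?thesis
      unfolding G_def dirichlet_zeta_recurrence[OF s, of N] by simp
  qed
  ultimately show ?case by blast
qed

text \<open>By the identity theorem the continuations to the half-planes agree where they are both
  defined, so they glue together.\<close>

lemma entire_continuation:
  "\<exists>F. F holomorphic_on UNIV \<and> (\<forall>s. Re s > 1 \<longrightarrow> F s = (s - 1) * dirichlet_zeta s)"
proof -
  obtain F where holo: "\<And>N. F N holomorphic_on {s. Re s > 1 - real N}"
    and F_eq: "\<And>N s. Re s > 1 \<Longrightarrow> F N s = (s - 1) * dirichlet_zeta s"
    using half_plane_continuation by metis
  have mono: "F M s = F N s" if "M \<le> N" "Re s > 1 - real M" for M N s
  proof (rule analytic_continuation_open[of "{s. Re s > 1}" "{s. Re s > 1 - real M}" "F M" "F N"])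
    show "F N holomorphic_on {s. Re s > 1 - real M}"
      using that by (intro holomorphic_on_subset[OF holo]) auto
    show "{s. Re s > 1} \<noteq> {}" by (auto intro!: exI[of _ 2])
  qed (use that holo F_eq in \<open>auto intro: open_halfspace_Re_gt convex_connected convex_halfspace_Re_gt\<close>)
  have agree: "F M s = F N s" if "Re s > 1 - real M" "Re s > 1 - real N" for M N s
    using that mono nat_le_linear by metis
  define k where "k = (\<lambda>s. nat \<lceil>2 - Re s\<rceil>)"
  have k: "Re s > 1 - real (k s)" for s
    unfolding k_def using real_nat_ceiling_ge[of "2 - Re s"] by linarith
  define G where "G = (\<lambda>s. F (k s) s)"
  have G_eq: "G s = F N s" if "Re s > 1 - real N" for N s
    unfolding G_def using agree[OF k that] .
  have "G holomorphic_on UNIV"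
  proof (rule holomorphic_on_subset)
    show "G holomorphic_on (\<Union>N. {s. Re s > 1 - real N})"
    proof (rule holomorphic_on_UN_open)
      show "G holomorphic_on {s. Re s > 1 - real N}" for N
        using holo by (rule holomorphic_transform) (simp add: G_eq)
    qed (rule open_halfspace_Re_gt)
    show "UNIV \<subseteq> (\<Union>N. {s. Re s > 1 - real N})"
      using k by blast
  qed
  moreover have "G s = (s - 1) * dirichlet_zeta s" if "Re s > 1" for s
    using F_eq[OF that] by (simp add: G_def)
  ultimately show ?thesis by blast
qed

text \<open>The function characterised in the definition of \<open>zeta\<close> exists, by dividing the entire
  continuation by \<open>s - 1\<close> (the value at 1 is then 0 because division by 0 gives 0), and it is unique
  by the identity theorem on the connected punctured plane.\<close>

lemma zeta_properties:
  shows holomorphic_zeta: "zeta holomorphic_on - {1}"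
    and zeta_eq_dirichlet_zeta: "Re s > 1 \<Longrightarrow> zeta s = dirichlet_zeta s"
proof -
  define P where "P = (\<lambda>f. f holomorphic_on - {1} \<and>
    (\<forall>s. Re s > 1 \<longrightarrow> f s = (\<Sum>n. 1 / of_nat (Suc n) powr s)) \<and> f 1 = (0::complex))"
  obtain F where F: "F holomorphic_on UNIV" "\<And>s. Re s > 1 \<Longrightarrow> F s = (s - 1) * dirichlet_zeta s"
    using entire_continuation by blast
  have "P (\<lambda>s. F s / (s - 1))"
    unfolding P_def dirichlet_zeta_def[symmetric]
    using F(2) by (auto intro!: holomorphic_intros holomorphic_on_subset[OF F(1)])
  moreover have "f = g" if "P f" "P g" for f g
  proof
    fix s
    show "f s = g s"
    proof (cases "s = 1")
      case False
      show ?thesis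
      proof (rule analytic_continuation_open[of "{s. Re s > 1}" "- {1}" f g])
        show "{s. Re s > 1} \<noteq> {}" by (auto intro!: exI[of _ 2])
        show "connected (- {1::complex})" by (intro connected_punctured_universe) simp
      qed (use that False in \<open>auto simp: P_def open_halfspace_Re_gt\<close>)
    qed (use that in \<open>auto simp: P_def\<close>)
  qed
  ultimately have "\<exists>!f. P f" by blast
  then have "P (THE f. P f)" by (rule theI')
  also have "(THE f. P f) = zeta" unfolding zeta_def P_def ..
  finally have "P zeta" .
  then show "zeta holomorphic_on - {1}" "Re s > 1 \<Longrightarrow> zeta s = dirichlet_zeta s"
    by (auto simp: P_def dirichlet_zeta_def)
qed

section \<open>Growth on vertical lines\<close>

text \<open>With first-order Taylor polynomials the recurrence has no shifted terms. What is left,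
  \<open>(s - 1) * zeta s = 1 + (\<Sum>n. taylor_rem 1 n s)\<close>, extends to \<open>Re s > 0\<close> by the identity theorem
  and can be estimated term by term.\<close>

lemma norm_zeta_le:
  assumes s: "Re s > 0" "s \<noteq> 1"
  shows "norm ((s - 1) * zeta s) \<le> 1 + norm ((s - 1) * s) * (\<Sum>n. real (Suc n) powr (- (Re s + 1)))"
proof -
  define U where "U = {s. Re s > 0} - {1::complex}"
  have U: "connected U"
    unfolding U_def by (rule connected_open_delete)
      (auto intro: open_halfspace_Re_gt convex_connected convex_halfspace_Re_gt)
  have "open U" unfolding U_def by (intro open_Diff open_halfspace_Re_gt) auto
  have series: "(s - 1) * zeta s = 1 + (\<Sum>n. taylor_rem 1 n s)"
  proof (rule analytic_continuation_open[of "{s. Re s > 1}" U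
           "\<lambda>s. (s - 1) * zeta s" "\<lambda>s. 1 + (\<Sum>n. taylor_rem 1 n s)"])
    show "{s. Re s > 1} \<noteq> {}" by (auto intro!: exI[of _ 2])
    show "(\<lambda>s. (s - 1) * zeta s) holomorphic_on U"
      by (intro holomorphic_intros holomorphic_on_subset[OF holomorphic_zeta]) (auto simp: U_def)
    show "(\<lambda>s. 1 + (\<Sum>n. taylor_rem 1 n s)) holomorphic_on U"
      by (intro holomorphic_intros holomorphic_on_subset[OF holomorphic_taylor_rem_suminf])
         (auto simp: U_def)
    show "(z - 1) * zeta z = 1 + (\<Sum>n. taylor_rem 1 n z)" if "z \<in> {s. Re s > 1}" for z
      using that dirichlet_zeta_recurrence[of z 0] by (simp add: zeta_eq_dirichlet_zeta)
  qed (use s U \<open>open U\<close> in \<open>auto simp: U_def open_halfspace_Re_gt\<close>)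
  have "norm (\<Sum>n. taylor_rem 1 n s) \<le> (\<Sum>n. norm ((s - 1) * s) * real (Suc n) powr (- (Re s + 1)))"
  proof (rule norm_suminf_le)
    show "norm (taylor_rem 1 n s) \<le> norm ((s - 1) * s) * real (Suc n) powr (- (Re s + 1))" for n
      using norm_taylor_rem_le[of s 1 n] s by (simp add: pochhammer_Suc)
    show "summable (\<lambda>n. norm ((s - 1) * s) * real (Suc n) powr (- (Re s + 1)))"
      using s by (intro summable_mult summable_Suc_powr) simp
  qed
  moreover have "(\<Sum>n. norm ((s - 1) * s) * real (Suc n) powr (- (Re s + 1)))
      = norm ((s - 1) * s) * (\<Sum>n. real (Suc n) powr (- (Re s + 1)))"
    using s by (intro suminf_mult summable_Suc_powr) simp
  ultimately show ?thesis
    unfolding series using norm_triangle_ineq[of 1 "\<Sum>n. taylor_rem 1 n s"] by simp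
qed

text \<open>In Euler's integral, \<open>t powr (z - 1)\<close> has the modulus \<open>t powr (Re z - 1)\<close>.\<close>

lemma norm_Gamma_le:
  fixes z :: complex
  assumes z: "Re z > 0"
  shows "norm (Gamma z) \<le> Gamma (Re z)"
proof -
  let ?f = "\<lambda>t. of_real t powr (z - 1) / of_real (exp t) :: complex"
  let ?g = "\<lambda>t. t powr (Re z - 1) / exp t"
  have f: "(?f has_integral Gamma z) {0..}" by (rule Gamma_integral_complex[OF z])
  have g: "(?g has_integral Gamma (Re z)) {0..}" by (rule Gamma_integral_real[OF z])
  have "norm (integral {0..} ?f) \<le> integral {0..} ?g"
  proof (rule integral_norm_bound_integral)
    show "?f integrable_on {0..}" "?g integrable_on {0..}"
      using f g by (auto simp: integrable_on_def)
    show "norm (?f t) \<le> ?g t" if "t \<in> {0..}" for t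
      using that by (simp add: norm_divide norm_powr_real_powr)
  qed
  then show ?thesis using f g by (simp add: integral_unique)
qed

text \<open>Each of the \<open>k\<close> factors in \<open>Gamma (z + k) = z (z + 1) ... (z + k - 1) * Gamma z\<close> has at least
  the modulus of \<open>z\<close>, and \<open>Gamma (z + k)\<close> is bounded on the vertical line through \<open>z\<close>.\<close>

lemma norm_Gamma_decay:
  fixes z :: complex
  assumes z: "Re z > 0"
  shows "norm (Gamma z) * norm z ^ k \<le> Gamma (Re z + k)"
proof -
  have "norm z ^ k \<le> norm (pochhammer z k)"
  proof (induction k)
    case (Suc k)
    have "norm z \<le> norm (z + of_nat k)"
      using z by (auto simp: cmod_def intro!: real_sqrt_le_mono power_mono)
    with Suc show ?case
      unfolding pochhammer_Suc norm_mult power_Suc2 by (intro mult_mono) auto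
  qed simp
  then have "norm (Gamma z) * norm z ^ k \<le> norm (Gamma z * pochhammer z k)"
    by (simp add: norm_mult mult_left_mono)
  also have "Gamma z * pochhammer z k = Gamma (z + of_nat k)"
  proof -
    have "z \<notin> \<int>\<^sub>\<le>\<^sub>0" using z by (auto elim!: nonpos_Ints_cases)
    then show ?thesis by (simp add: pochhammer_Gamma Gamma_eq_zero_iff)
  qed
  also have "norm \<dots> \<le> Gamma (Re z + k)"
    using norm_Gamma_le[of "z + of_nat k"] z by simp
  finally show ?thesis .
qed


text \<open>On the critical line \<open>s\<close> and \<open>s - 1\<close> have the same modulus \<open>r \<ge> 1 / 2\<close>. In \<open>xi s\<close> the factor
  \<open>(s - 1) * zeta s\<close> is of order \<open>r\<^sup>2\<close> and \<open>s\<close> is of order \<open>r\<close>, so five powers gained from the Gamma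
  factor leave \<open>1 / r\<^sup>2\<close>.\<close>

lemma norm_xi_critical_line_bounded:
  "\<exists>C. \<forall>s. Re s = 1 / 2 \<longrightarrow> norm (xi s) * norm s ^ 2 \<le> C"
proof -
  define A where "A = (\<Sum>n. real (Suc n) powr (- (1 / 2 + 1)))"
  have A: "A \<ge> 0" unfolding A_def by (intro suminf_nonneg summable_Suc_powr) auto
  have "norm (xi s) * norm s ^ 2 \<le> 16 * (4 + A) * Gamma (21 / 4)" if s: "Re s = 1 / 2" for s
  proof -
    define r where "r = norm s"
    have r: "r \<ge> 1 / 2" using s complex_Re_le_cmod[of s] by (simp add: r_def)
    have r1: "norm (s - 1) = r" using s by (simp add: r_def cmod_def power2_eq_iff)
    have "s \<noteq> 1" using s by auto
    then have zeta: "norm ((s - 1) * zeta s) \<le> 1 + A * r\<^sup>2"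
      using norm_zeta_le[of s] s r1
      by (simp add: A_def norm_mult r_def power2_eq_square mult.commute)
    have Gamma: "norm (Gamma (s / 2)) * (r / 2) ^ 5 \<le> Gamma (21 / 4)"
      using norm_Gamma_decay[of "s / 2" 5] s by (simp add: r_def norm_divide)
    have pi_powr: "norm (of_real pi powr (- s / 2) :: complex) \<le> 1"
    proof -
      have "norm (of_real pi powr (- s / 2) :: complex) = pi powr Re (- s / 2)"
        by (subst norm_powr_real_powr) auto
      also have "\<dots> \<le> pi powr 0" using s pi_gt3 by (intro powr_mono) auto
      finally show ?thesis by simp
    qed
    have "norm (xi s) = r / 2 * norm (of_real pi powr (- s / 2) :: complex)
        * norm (Gamma (s / 2)) * norm ((s - 1) * zeta s)"
      by (simp add: xi_def norm_mult norm_divide r_def)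
    also have "\<dots> \<le> r / 2 * 1 * norm (Gamma (s / 2)) * norm ((s - 1) * zeta s)"
      using pi_powr r by (intro mult_right_mono mult_left_mono) auto
    also have "\<dots> \<le> r / 2 * 1 * norm (Gamma (s / 2)) * (1 + A * r\<^sup>2)"
      using zeta r by (intro mult_left_mono) auto
    finally have "norm (xi s) * r\<^sup>2 \<le> r / 2 * norm (Gamma (s / 2)) * (1 + A * r\<^sup>2) * r\<^sup>2"
      by (intro mult_right_mono) auto
    also have "\<dots> = norm (Gamma (s / 2)) * r ^ 3 / 2 * (1 + A * r\<^sup>2)"
      by (simp add: power2_eq_square power3_eq_cube)
    also have "\<dots> \<le> norm (Gamma (s / 2)) * r ^ 3 / 2 * ((4 + A) * r\<^sup>2)"
    proof (intro mult_left_mono)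
      \<comment> \<open>The constant 1 is absorbed into \<open>4 * r\<^sup>2\<close>.\<close>
      have "(1 / 2)\<^sup>2 \<le> r\<^sup>2" using r by (intro power_mono) auto
      then show "1 + A * r\<^sup>2 \<le> (4 + A) * r\<^sup>2" by (simp add: power2_eq_square algebra_simps)
    qed (use r in auto)
    also have "\<dots> = 16 * (4 + A) * (norm (Gamma (s / 2)) * (r / 2) ^ 5)"
      by (simp add: power_divide numeral_eq_Suc)
    also have "\<dots> \<le> 16 * (4 + A) * Gamma (21 / 4)"
      using Gamma A by (intro mult_left_mono) auto
    finally show ?thesis by (simp add: r_def)
  qed
  then show ?thesis by blast
qed

section \<open>Integrability and cancellation\<close>

lemma continuous_on_Xi_real: "continuous_on UNIV Xi_real"
proof -
  define U where "U = {s. Re s > 0} - {1::complex}"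
  have xi: "xi = (\<lambda>s. s * (s - 1) / 2 * of_real pi powr (- s / 2) * Gamma (s / 2) * zeta s)"
    by (simp add: fun_eq_iff xi_def)
  have "xi holomorphic_on U"
    unfolding xi by (intro holomorphic_intros holomorphic_on_subset[OF holomorphic_zeta])
      (auto simp: U_def elim!: nonpos_Ints_cases')
  then have "continuous_on U xi" by (rule holomorphic_on_imp_continuous_on)
  then have "continuous_on UNIV (\<lambda>t. xi (1 / 2 + \<i> * of_real t))"
  proof (rule continuous_on_compose2)
    show "continuous_on UNIV (\<lambda>t. 1 / 2 + \<i> * of_real t)" by (intro continuous_intros)
    show "range (\<lambda>t. 1 / 2 + \<i> * of_real t) \<subseteq> U" by (auto simp: U_def complex_eq_iff)
  qed
  then show ?thesis
    unfolding Xi_real_def[abs_def] Xi_def by (rule continuous_on_Re)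
qed

lemma Xi_real_bound: "\<exists>C. \<forall>t. \<bar>Xi_real t\<bar> * t\<^sup>2 \<le> C"
proof -
  obtain C where C: "\<And>s. Re s = 1 / 2 \<Longrightarrow> norm (xi s) * norm s ^ 2 \<le> C"
    using norm_xi_critical_line_bounded by blast
  have "\<bar>Xi_real t\<bar> * t\<^sup>2 \<le> C" for t
  proof -
    let ?s = "1 / 2 + \<i> * of_real t :: complex"
    have "\<bar>Xi_real t\<bar> \<le> norm (xi ?s)" unfolding Xi_real_def Xi_def by (rule abs_Re_le_cmod)
    moreover have "t\<^sup>2 \<le> norm ?s ^ 2" by (simp add: cmod_power2)
    ultimately have "\<bar>Xi_real t\<bar> * t\<^sup>2 \<le> norm (xi ?s) * norm ?s ^ 2" by (intro mult_mono) auto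
    also have "\<dots> \<le> C" by (rule C) simp
    finally show ?thesis .
  qed
  then show ?thesis by blast
qed

lemma set_integrable_inverse_square:
  assumes "a > (0::real)"
  shows "set_integrable lborel {a..} (\<lambda>t. 1 / t\<^sup>2)"
proof -
  have "(\<lambda>t. 1 / t\<^sup>2) integrable_on {a..}"
    using has_integral_inverse_power_to_inf[of 2 a] assms by (auto simp: integrable_on_def)
  then have "set_integrable lebesgue {a..} (\<lambda>t. 1 / t\<^sup>2)"
    by (rule nonnegative_absolutely_integrable_1) simp
  then show ?thesis
    unfolding set_integrable_def by (subst (asm) integrable_completion) auto
qed

lemma set_integrable_Xi_real:
  assumes a: "a > 0"
  shows "set_integrable lborel {a..} Xi_real"
proof -
  obtain C where C: "\<And>t. \<bar>Xi_real t\<bar> * t\<^sup>2 \<le> C" using Xi_real_bound by blast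
  show ?thesis
  proof (rule set_integrable_bound)
    show "set_integrable lborel {a..} (\<lambda>t. C * (1 / t\<^sup>2))"
      using set_integrable_inverse_square[OF a] by (intro set_integrable_mult_right)
    have "Xi_real \<in> borel_measurable borel"
      using continuous_on_Xi_real by (rule borel_measurable_continuous_onI)
    then show "set_borel_measurable lborel {a..} Xi_real"
      unfolding set_borel_measurable_def by measurable
    have "norm (Xi_real t) \<le> norm (C * (1 / t\<^sup>2))" if "t \<ge> a" for t
    proof -
      have "norm (Xi_real t) \<le> C * (1 / t\<^sup>2)" using C[of t] a that by (simp add: field_simps)
      then show ?thesis by (rule order_trans) (simp add: divide_right_mono)
    qed
    then show "AE t in lborel. t \<in> {a..} \<longrightarrow> norm (Xi_real t) \<le> norm (C * (1 / t\<^sup>2))"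
      by (intro AE_I2) auto
  qed
qed

lemma set_integral_pos_part_eq_neg_part:
  fixes f :: "real \<Rightarrow> real"
  assumes f: "set_integrable M A f" and zero: "(LINT t:A|M. f t) = 0"
    and meas: "f \<in> borel_measurable M" "A \<in> sets M"
  shows "(LINT t:{t \<in> A. f t > 0}|M. f t) = - (LINT t:{t \<in> A. f t < 0}|M. f t)"
proof -
  let ?P = "{t \<in> A. f t > 0}" and ?N = "{t \<in> A. f t < 0}"
  have PN: "?P = A \<inter> {t \<in> space M. f t > 0}" "?N = A \<inter> {t \<in> space M. f t < 0}"
    using sets.sets_into_space[OF meas(2)] by auto
  have sets: "?P \<in> sets M" "?N \<in> sets M"
    using meas unfolding PN by measurable
  have "(LINT t:A|M. f t) = (LINT t:?P \<union> ?N|M. f t)"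
    unfolding set_lebesgue_integral_def
    by (intro Bochner_Integration.integral_cong refl) (auto simp: indicator_def)
  also have "\<dots> = (LINT t:?P|M. f t) + (LINT t:?N|M. f t)"
    using sets by (intro set_integral_Un set_integrable_subset[OF f]) auto
  finally show ?thesis using zero by simp
qed

theorem corollary2:
  fixes \<epsilon> :: real and \<omega> :: "nat \<Rightarrow> real"
  assumes "\<epsilon> > 0"
    and "mono_on {1..} \<omega>"
    and "\<And>n. n \<ge> 1 \<Longrightarrow> \<omega> n > 0"
    and "\<And>n. n \<ge> 1 \<Longrightarrow> (LBINT t=\<omega> n..\<infinity>. Xi_real t) = 0"
    and "\<And>n. n \<ge> 1 \<Longrightarrow> \<omega> (n + 1) - \<omega> n < \<omega> n powr (1 / 6 + \<epsilon>)"
  shows "(\<forall>n\<ge>1. (LBINT t=\<omega> n..\<omega> (n + 1). Xi_real t) = 0) \<and>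
         (\<forall>n\<ge>1. (LBINT t:{t \<in> {\<omega> n..\<omega> (n + 1)}. Xi_real t > 0}. Xi_real t) =
               - (LBINT t:{t \<in> {\<omega> n..\<omega> (n + 1)}. Xi_real t < 0}. Xi_real t))"
proof -
  have le: "\<omega> n \<le> \<omega> (n + 1)" if "n \<ge> 1" for n
    using that by (intro mono_onD[OF assms(2)]) auto
  have zero: "(LBINT t=\<omega> n..\<omega> (n + 1). Xi_real t) = 0" if n: "n \<ge> 1" for n
  proof -
    have "set_integrable lborel {\<omega> n<..} Xi_real"
      by (rule set_integrable_subset[OF set_integrable_Xi_real[OF assms(3)[OF n]]]) auto
    then have "interval_lebesgue_integrable lborel (\<omega> n) \<infinity> Xi_real"
      by (simp add: interval_integrable_to_infinity_eq)
    then have "(LBINT t=\<omega> n..\<omega> (n + 1). Xi_real t) + (LBINT t=\<omega> (n + 1)..\<infinity>. Xi_real t)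
        = (LBINT t=\<omega> n..\<infinity>. Xi_real t)"
      using le[OF n] by (intro interval_integral_sum) (simp add: min_def max_def)
    then show ?thesis using assms(4)[of n] assms(4)[of "n + 1"] n by simp
  qed
  moreover have "(LBINT t:{t \<in> {\<omega> n..\<omega> (n + 1)}. Xi_real t > 0}. Xi_real t) =
      - (LBINT t:{t \<in> {\<omega> n..\<omega> (n + 1)}. Xi_real t < 0}. Xi_real t)" if n: "n \<ge> 1" for n
  proof (rule set_integral_pos_part_eq_neg_part)
    show "set_integrable lborel {\<omega> n..\<omega> (n + 1)} Xi_real"
      by (rule set_integrable_subset[OF set_integrable_Xi_real[OF assms(3)[OF n]]]) auto
    show "(LBINT t:{\<omega> n..\<omega> (n + 1)}. Xi_real t) = 0"
      using zero[OF n] le[OF n] by (simp add: interval_integral_Icc)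
    show "Xi_real \<in> borel_measurable lborel"
      using borel_measurable_continuous_onI[OF continuous_on_Xi_real] by simp
  qed simp
  ultimately show ?thesis by blast
qed

end
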